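(* Let $\mathcal H$ be a complex Hilbert space. Then the Banach–Lie algebra $\mathfrak u(\mathcal H)/\mathbb Ri\mathbf 1$ has no non-trivial open invariant cones; i.e., every non-empty open convex cone in $\mathfrak u(\mathcal H)$ that is invariant under the adjoint action of $U(\mathcal H)$ intersects $\mathbb Ri\mathbf 1$.
   Context: $\mathfrak u(\mathcal H)$ is the Banach–Lie algebra of bounded skew-hermitian operators on $\mathcal H$ with the operator norm, acted upon by $U(\mathcal H)$ via $\mathrm{Ad}(g)x=gxg^{-1}$. A convex cone $W$ satisfies $W+W\subseteq W$ and $tW\subseteq W$ for $t>0$. A Banach–Lie algebra has no non-trivial open invariant cones if every non-empty open convex cone invariant under all $e^{\mathrm{ad}\,x}$ is the whole algebra. *)

theory Defs
  imports "HOL-Analysis.Analysis"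
begin

text \<open>A complex Hilbert space is modelled as a real Hilbert space
  (type class real_inner + complete_space) together with an orthogonal complex
  structure J (multiplication by i): J J = -1 and J preserves the real inner
  product. The complex inner product is then inner x y + i inner x (J y).\<close>

definition complex_structure :: "('a::real_inner \<Rightarrow>\<^sub>L 'a) \<Rightarrow> bool" where
  "complex_structure J \<longleftrightarrow> J o\<^sub>L J = - id_blinfun \<and>
     (\<forall>x y. inner (J x) (J y) = inner x y)"

definition u_alg :: "('a::real_inner \<Rightarrow>\<^sub>L 'a) \<Rightarrow> ('a \<Rightarrow>\<^sub>L 'a) set" where
  "u_alg J = {T. T o\<^sub>L J = J o\<^sub>L T \<and> (\<forall>x y. inner (T x) y = - inner x (T y))}"

definition unitary_pair ::
  "('a::real_inner \<Rightarrow>\<^sub>L 'a) \<Rightarrow> ('a \<Rightarrow>\<^sub>L 'a) \<Rightarrow> ('a \<Rightarrow>\<^sub>L 'a) \<Rightarrow> bool" where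
  "unitary_pair J g h \<longleftrightarrow> g o\<^sub>L J = J o\<^sub>L g \<and> g o\<^sub>L h = id_blinfun \<and>
     h o\<^sub>L g = id_blinfun \<and> (\<forall>x y. inner (g x) (g y) = inner x y)"

definition convex_cone_set :: "'b::real_vector set \<Rightarrow> bool" where
  "convex_cone_set W \<longleftrightarrow> (\<forall>x\<in>W. \<forall>y\<in>W. x + y \<in> W) \<and>
     (\<forall>t>0. \<forall>x\<in>W. t *\<^sub>R x \<in> W)"

end

theory Submission
  imports Defs
begin

text \<open>This is Dixmier averaging. For a symmetric operator \<open>B\<close> with \<open>\<parallel>B\<parallel> \<le> w\<close>, split the space
  into the parts where \<open>B \<ge> 0\<close> and \<open>B \<le> 0\<close>, embed one of them isometrically into the other, and
  let the unitary \<open>u\<close> swap the embedded part with its image. If the positive part is the one that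
  embeds, then \<open>- w \<le> (B + u B u)/2 \<le> w/2\<close>, so the distance to the scalars shrinks by the factor
  3/4; the other case is symmetric. Iterating, the convex hull of the unitary orbit of any element
  of \<open>W\<close> comes arbitrarily close to the line spanned by \<open>J\<close>. Conjugation is isometric, so all these averages
  are centres of balls in \<open>W\<close> of one fixed radius.\<close>

section \<open>Reflections in closed subspaces\<close>

text \<open>A minimising sequence for the distance to \<open>N\<close> is Cauchy by the
  parallelogram law, and the first variation at its limit gives the orthogonality.\<close>

lemma orthogonal_decomposition:
  fixes N :: "'a::{real_inner, complete_space} set" and x :: 'a
  assumes N: "subspace N" "closed N"
  obtains y where "y \<in> N" "\<And>z. z \<in> N \<Longrightarrow> inner (x - y) z = 0"
proof -
  define D where "D = (INF y\<in>N. (norm (x - y))\<^sup>2)"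
  have bdd: "bdd_below ((\<lambda>y. (norm (x - y))\<^sup>2) ` N)"
    by (rule bdd_belowI2[of _ 0]) simp
  have ne: "N \<noteq> {}" using subspace_0[OF N(1)] by blast
  have D: "D \<le> (norm (x - y))\<^sup>2" if "y \<in> N" for y
    unfolding D_def by (rule cINF_lower[OF bdd that])
  have "\<exists>y\<in>N. (norm (x - y))\<^sup>2 < D + 1 / real (Suc n)" for n
    using cINF_less_iff[OF ne bdd, of "D + 1 / real (Suc n)"] unfolding D_def by simp
  then obtain Y where Y: "\<And>n. Y n \<in> N" "\<And>n. (norm (x - Y n))\<^sup>2 < D + 1 / real (Suc n)"
    by metis
  \<comment> \<open>The midpoint of \<open>Y m\<close> and \<open>Y n\<close> lies in
    \<open>N\<close>, so its squared distance to \<open>x\<close> is at least \<open>D\<close>;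
    near-minimality of both points then bounds their gap.\<close>
  have diff: "(norm (Y m - Y n))\<^sup>2 \<le> 2 / real (Suc m) + 2 / real (Suc n)" for m n
  proof -
    have "(1/2) *\<^sub>R (Y m + Y n) \<in> N"
      by (intro subspace_scale subspace_add N Y)
    from D[OF this] have "4 * D \<le> (norm (2 *\<^sub>R (x - (1/2) *\<^sub>R (Y m + Y n))))\<^sup>2"
      by (simp add: power_mult_distrib)
    also have "2 *\<^sub>R (x - (1/2) *\<^sub>R (Y m + Y n)) = (x - Y m) + (x - Y n)"
      by (simp add: algebra_simps scaleR_2)
    also have "(norm ((x - Y m) + (x - Y n)))\<^sup>2 = 2 * (norm (x - Y m))\<^sup>2 + 2 * (norm (x - Y n))\<^sup>2
        - (norm (Y m - Y n))\<^sup>2"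
      unfolding power2_norm_eq_inner by (simp add: inner_simps inner_commute algebra_simps)
    finally show ?thesis using Y(2)[of m] Y(2)[of n] by simp
  qed
  have "Cauchy Y"
  proof (rule metric_CauchyI)
    fix e :: real assume "e > 0"
    then obtain M where M: "1 / real (Suc M) < e\<^sup>2 / 4"
      using nat_approx_posE[of "e\<^sup>2 / 4"] by auto
    have "dist (Y m) (Y n) < e" if "m \<ge> M" "n \<ge> M" for m n
    proof -
      have "2 / real (Suc m) \<le> 2 / real (Suc M)" "2 / real (Suc n) \<le> 2 / real (Suc M)"
        using that by (auto simp: field_simps)
      then have "(norm (Y m - Y n))\<^sup>2 < e\<^sup>2" using diff[of m n] M by simp
      then show ?thesis using \<open>e > 0\<close> by (simp add: dist_norm power_less_imp_less_base)
    qed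
    then show "\<exists>M. \<forall>m\<ge>M. \<forall>n\<ge>M. dist (Y m) (Y n) < e" by blast
  qed
  then obtain y where lim: "Y \<longlonglongrightarrow> y"
    using Cauchy_convergent_iff convergent_def by blast
  have yN: "y \<in> N" using closed_sequentially[OF N(2) _ lim] Y(1) by blast
  have "(\<lambda>n. (norm (x - Y n))\<^sup>2) \<longlonglongrightarrow> (norm (x - y))\<^sup>2" by (intro tendsto_intros lim)
  moreover have "(\<lambda>n. D + 1 / real (Suc n)) \<longlonglongrightarrow> D + 0"
    by (intro tendsto_intros LIMSEQ_Suc[OF lim_1_over_n])
  ultimately have "(norm (x - y))\<^sup>2 \<le> D + 0"
    by (rule LIMSEQ_le) (use Y(2) less_imp_le in blast)
  then have yD: "(norm (x - y))\<^sup>2 \<le> D" by simp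
  have "inner (x - y) z = 0" if z: "z \<in> N" for z
  proof (cases "z = 0")
    case False
    \<comment> \<open>This \<open>t\<close> minimises the squared distance from \<open>x\<close> to
      \<open>y + t z\<close>; the drop there is \<open>(inner (x - y) z)^2 / inner z z\<close>,
      which minimality of \<open>y\<close> forces to vanish.\<close>
    define t where "t = inner (x - y) z / inner z z"
    have "y + t *\<^sub>R z \<in> N" using N(1) yN z by (simp add: subspace_add subspace_scale)
    from D[OF this] yD have "(norm (x - y))\<^sup>2 \<le> (norm (x - (y + t *\<^sub>R z)))\<^sup>2" by (rule order_trans[rotated])
    also have "\<dots> = (norm (x - y))\<^sup>2 - 2 * t * inner (x - y) z + t\<^sup>2 * inner z z"
      unfolding power2_norm_eq_inner
      by (simp add: inner_simps inner_commute algebra_simps power2_eq_square)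
    also have "\<dots> = (norm (x - y))\<^sup>2 - (inner (x - y) z)\<^sup>2 / inner z z"
      using False by (simp add: t_def field_simps power2_eq_square)
    finally have "(inner (x - y) z)\<^sup>2 / inner z z \<le> 0" by simp
    moreover have "inner z z > 0" using False by simp
    ultimately show ?thesis by (simp add: divide_le_0_iff)
  qed simp
  with yN show ?thesis using that by blast
qed

text \<open>These are the self-adjoint complex-linear unitaries. Such a \<open>u\<close> is its own
  inverse, so conjugation by it is simply \<open>u o\<^sub>L T o\<^sub>L u\<close>.\<close>

definition symmetric_unitary :: "('a::real_inner \<Rightarrow>\<^sub>L 'a) \<Rightarrow> ('a \<Rightarrow>\<^sub>L 'a) \<Rightarrow> bool" where
  "symmetric_unitary J u \<longleftrightarrow> (\<forall>x. u (u x) = x) \<and> (\<forall>x. u (J x) = J (u x)) \<and>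
     (\<forall>x y. inner (u x) y = inner x (u y))"

lemma symmetric_unitaryD:
  assumes "symmetric_unitary J u"
  shows "u (u x) = x" "u (J x) = J (u x)" "inner (u x) y = inner x (u y)"
    and "inner (u x) (u y) = inner x y" "norm (u x) = norm x"
  using assms unfolding symmetric_unitary_def by (auto simp: norm_eq_sqrt_inner)

lemma norm_blinfun_le_1:
  fixes u :: "'a::real_normed_vector \<Rightarrow>\<^sub>L 'a"
  assumes "\<And>x. norm (u x) = norm x"
  shows "norm u \<le> 1"
  by (rule norm_blinfun_bound) (simp_all add: assms)

lemma complex_structureD:
  assumes "complex_structure J"
  shows "J (J x) = - x" "inner (J x) (J y) = inner x y" "inner (J x) y = - inner x (J y)"
    and "norm (J x) = norm x"
proof -
  have JJ: "J (J x) = - x" for x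
    using assms blinfun_apply_blinfun_compose[of J J x]
    by (simp add: complex_structure_def uminus_blinfun.rep_eq)
  have iso: "inner (J x) (J y) = inner x y" for x y
    using assms by (simp add: complex_structure_def)
  show "J (J x) = - x" "inner (J x) (J y) = inner x y" by (fact JJ iso)+
  show "inner (J x) y = - inner x (J y)" using iso[of "J x" y] by (simp add: JJ)
  show "norm (J x) = norm x" by (simp add: norm_eq_sqrt_inner iso)
qed

text \<open>Take \<open>1 - 2 p\<close> with \<open>p\<close> the orthogonal projection onto
  \<open>N\<close>. Uniqueness of the foot point makes \<open>p\<close> linear and, as
  \<open>N\<close> is invariant under \<open>J\<close>, complex linear.\<close>

lemma reflection_exists:
  fixes J :: "'a::{real_inner, complete_space} \<Rightarrow>\<^sub>L 'a"
  assumes J: "complex_structure J" and N: "subspace N" "closed N" "\<And>x. x \<in> N \<Longrightarrow> J x \<in> N"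
  obtains u where "symmetric_unitary J u" "\<And>x. x \<in> N \<Longrightarrow> u x = - x"
    "\<And>x. (\<And>z. z \<in> N \<Longrightarrow> inner x z = 0) \<Longrightarrow> u x = x"
proof -
  have "\<forall>x. \<exists>y. y \<in> N \<and> (\<forall>z\<in>N. inner (x - y) z = 0)"
    by (metis orthogonal_decomposition[OF N(1,2)])
  then obtain p where p: "\<And>x. p x \<in> N" "\<And>x z. z \<in> N \<Longrightarrow> inner (x - p x) z = 0"
    by metis
  have uniq: "p x = y" if "y \<in> N" "\<And>z. z \<in> N \<Longrightarrow> inner (x - y) z = 0" for x y
  proof -
    have "p x - y \<in> N" using p(1) that(1) N(1) by (simp add: subspace_diff)
    from p(2)[OF this, of x] that(2)[OF this] have "inner (p x - y) (p x - y) = 0"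
      by (simp add: inner_simps)
    then show ?thesis by simp
  qed
  have add: "p (x + y) = p x + p y" for x y
    using p(2)[of _ x] p(2)[of _ y]
    by (intro uniq subspace_add N p) (simp add: inner_simps)
  have scale: "p (c *\<^sub>R x) = c *\<^sub>R p x" for c x
    using p(2)[of _ x] by (intro uniq subspace_scale N p) (simp add: inner_simps)
  have sym: "inner (p x) y = inner x (p y)" for x y
    using p(2)[OF p(1)[of y], of x] p(2)[OF p(1)[of x], of y]
    by (simp add: inner_simps inner_commute)
  have Jp: "p (J x) = J (p x)" for x
  proof (rule uniq)
    fix z assume "z \<in> N"
    have "inner (J x - J (p x)) z = - inner (x - p x) (J z)"
      using complex_structureD(3)[OF J] by (simp flip: blinfun.diff_right)
    also have "\<dots> = 0" using p(2)[OF N(3)[OF \<open>z \<in> N\<close>]] by simp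
    finally show "inner (J x - J (p x)) z = 0" .
  qed (intro N p)
  define v where "v x = x - 2 *\<^sub>R p x" for x
  have vv: "v (v x) = x" for x
  proof -
    have "p (x - 2 *\<^sub>R p x) = - p x"
    proof (rule uniq)
      have eq: "x - 2 *\<^sub>R p x - - p x = x - p x" by (simp add: scaleR_2)
      show "inner (x - 2 *\<^sub>R p x - - p x) z = 0" if "z \<in> N" for z
        unfolding eq by (rule p(2)[OF that])
    qed (intro subspace_neg N p)
    then show ?thesis by (simp add: v_def)
  qed
  have vsym: "inner (v x) y = inner x (v y)" for x y by (simp add: v_def inner_simps sym)
  have vnorm: "norm (v x) = norm x" for x by (simp add: norm_eq_sqrt_inner vsym vv)
  have "bounded_linear v"
    by (rule bounded_linear_intro[of _ 1])
      (simp_all add: vnorm, simp_all add: v_def add scale algebra_simps)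
  then have app: "blinfun_apply (Blinfun v) = v" by (rule bounded_linear_Blinfun_apply)
  show thesis
  proof (rule that[of "Blinfun v"])
    show "symmetric_unitary J (Blinfun v)" unfolding symmetric_unitary_def app
      by (simp add: vv vsym) (simp add: v_def Jp blinfun.diff_right blinfun.scaleR_right)
    show "blinfun_apply (Blinfun v) x = - x" if "x \<in> N" for x
    proof -
      have "p x = x" by (rule uniq) (simp_all add: that)
      then show ?thesis by (simp add: app v_def scaleR_2)
    qed
    show "blinfun_apply (Blinfun v) x = x" if "\<And>z. z \<in> N \<Longrightarrow> inner x z = 0" for x
    proof -
      have "p x = 0" by (rule uniq) (simp_all add: that subspace_0 N)
      then show ?thesis by (simp add: app v_def)
    qed
  qed
qed

section \<open>The sign of a symmetric operator\<close>


text \<open>\<open>S\<close> is the absolute value of \<open>B\<close>. The last clause, applied to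
  \<open>C = B\<close> and \<open>C = J\<close>, is what makes the sign built from \<open>S\<close>
  commute with both.\<close>

lemma abs_operator_exists:
  fixes B :: "'a::{real_inner, complete_space} \<Rightarrow>\<^sub>L 'a"
  assumes sym: "\<And>x y. inner (B x) y = inner x (B y)" and nB: "norm B \<le> 1"
  obtains S :: "'a \<Rightarrow>\<^sub>L 'a" where "\<And>x. S (S x) = B (B x)"
    "\<And>x. inner (S x) x \<ge> 0" "\<And>x y. inner (S x) y = inner x (S y)"
    "\<And>(C :: 'a \<Rightarrow>\<^sub>L 'a) x. (\<And>x. C (B x) = B (C x)) \<Longrightarrow> C (S x) = S (C x)"
proof -
  text \<open>With \<open>X = 1 - B\<^sup>2\<close> the operator \<open>1 - S\<close> is the fixed point of
    \<open>Y \<mapsto> (X + Y\<^sup>2)/2\<close>; the scalar iteration \<open>y\<close> with \<open>X = 1\<close> majorises the increments.\<close>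
  define X where "X = id_blinfun - (B o\<^sub>L B)"
  define Y where "Y = rec_nat 0 (\<lambda>_ Z. (1/2) *\<^sub>R (X + (Z o\<^sub>L Z)))"
  define y :: "nat \<Rightarrow> real" where "y = rec_nat 0 (\<lambda>_ t. (1 + t * t) / 2)"
  have Y0: "Y 0 = 0" and YS: "\<And>n x. Y (Suc n) x = (1/2) *\<^sub>R (X x + Y n (Y n x))"
    by (simp_all add: Y_def blinfun.add_left blinfun.scaleR_left)
  have y0: "y 0 = 0" and yS: "\<And>n. y (Suc n) = (1 + y n * y n) / 2" by (simp_all add: y_def)
  have X: "X x = x - B (B x)" for x by (simp add: X_def blinfun.diff_left)
  have Bx: "norm (B x) \<le> norm x" for x
    using norm_blinfun[of B x] mult_right_mono[OF nB norm_ge_zero[of x]] by simp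
  \<comment> \<open>After expanding the square, \<open>norm (B (B x))\<close> is absorbed by
    \<open>norm (B x)\<close>, since \<open>B\<close> is a contraction.\<close>
  have Xx: "norm (X x) \<le> norm x" for x
  proof -
    have "(norm (X x))\<^sup>2 = (norm x)\<^sup>2 - 2 * (norm (B x))\<^sup>2 + (norm (B (B x)))\<^sup>2"
      unfolding power2_norm_eq_inner X using sym[of "B x" x]
      by (simp add: inner_simps inner_commute)
    also have "\<dots> \<le> (norm x)\<^sup>2"
      using power_mono[OF Bx[of "B x"] norm_ge_zero, of 2] zero_le_power2[of "norm (B x)"] by linarith
    finally show ?thesis by (rule power2_le_imp_le) simp
  qed
  have y01: "0 \<le> y n \<and> y n \<le> 1" for n
  proof (induction n)
    case (Suc n)
    then have "y n * y n \<le> 1 * 1" by (intro mult_mono) auto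
    then show ?case using Suc by (simp add: yS)
  qed (simp add: y0)
  \<comment> \<open>Each iterate is a polynomial in \<open>B^2\<close>. Choosing
    \<open>C = B\<close> and then \<open>C = Y m\<close> shows that the iterates commute with one
    another.\<close>
  have comm: "C (Y n x) = Y n (C x)" if C: "\<And>x. C (B x) = B (C x)" for C :: "'a \<Rightarrow>\<^sub>L 'a" and n x
    by (induction n arbitrary: x)
      (simp_all add: Y0 YS X C blinfun.add_right blinfun.diff_right blinfun.scaleR_right)
  have YB: "Y n (B x) = B (Y n x)" for n x using comm[of B] by simp
  have YY: "Y m (Y n x) = Y n (Y m x)" for m n x using comm[of "Y m", OF YB] .
  have Ysym: "inner (Y n x) z = inner x (Y n z)" for n x z
    by (induction n arbitrary: x z) (simp_all add: Y0 YS X inner_simps sym)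
  have Yy: "norm (Y n x) \<le> y n * norm x" for n x
  proof (induction n arbitrary: x)
    case (Suc n)
    have "norm (Y n (Y n x)) \<le> y n * (y n * norm x)"
      using Suc[of "Y n x"] mult_left_mono[OF Suc[of x], of "y n"] y01[of n] by linarith
    then have "norm (X x + Y n (Y n x)) \<le> (1 + y n * y n) * norm x"
      using norm_triangle_ineq[of "X x" "Y n (Y n x)"] Xx[of x] by (simp add: algebra_simps)
    then show ?case by (simp add: YS yS)
  qed (simp add: Y0 y0)
  have Y1: "norm (Y n x) \<le> norm x" for n x
    using Yy[of n x] mult_right_mono[of "y n" 1 "norm x"] y01[of n] by simp
  \<comment> \<open>As the iterates commute, the difference of squares factors, so the next
    increment is half of \<open>Y (Suc n) + Y n\<close> applied to the current one. The scalars
    \<open>y\<close> obey the same recursion with equality.\<close>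
  have step: "y n \<le> y (Suc n) \<and> norm (Y (Suc n) x - Y n x) \<le> (y (Suc n) - y n) * norm x" for n x
  proof (induction n arbitrary: x)
    case 0
    then show ?case using Xx[of x] by (simp add: Y0 YS y0 yS)
  next
    case (Suc n)
    define D where "D = Y (Suc n) x - Y n x"
    have "Y (Suc (Suc n)) x - Y (Suc n) x =
        (1/2) *\<^sub>R (Y (Suc n) (Y (Suc n) x) - Y n (Y n x))"
      by (simp only: YS[of "Suc n"] YS[of n x]) (simp flip: scaleR_diff_right)
    also have "Y (Suc n) (Y (Suc n) x) - Y n (Y n x) = Y (Suc n) D + Y n D"
      by (simp add: D_def blinfun.diff_right YY[of "Suc n" n])
    finally have "norm (Y (Suc (Suc n)) x - Y (Suc n) x) \<le> (1/2) * norm (Y (Suc n) D + Y n D)"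
      by simp
    also have "\<dots> \<le> (1/2) * ((y (Suc n) + y n) * norm D)"
      using norm_triangle_ineq[of "Y (Suc n) D" "Y n D"] Yy[of "Suc n" D] Yy[of n D]
      by (simp add: algebra_simps)
    also have "\<dots> \<le> (1/2) * ((y (Suc n) + y n) * ((y (Suc n) - y n) * norm x))"
      using Suc[of x] y01[of n] y01[of "Suc n"]
      by (intro mult_left_mono) (auto simp: D_def)
    also have "\<dots> = (y (Suc (Suc n)) - y (Suc n)) * norm x"
      by (simp add: yS[of "Suc n"] yS[of n] field_simps)
    finally have "norm (Y (Suc (Suc n)) x - Y (Suc n) x) \<le> (y (Suc (Suc n)) - y (Suc n)) * norm x" .
    moreover have "y n * y n \<le> y (Suc n) * y (Suc n)"
      using Suc[of x] y01[of n] by (intro mult_mono) auto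
    then have "y (Suc n) \<le> y (Suc (Suc n))" by (metis add_left_mono divide_right_mono yS zero_le_numeral)
    ultimately show ?case by blast
  qed
  have incy: "incseq y" using step by (simp add: incseq_SucI)
  have diff: "norm (Y m x - Y n x) \<le> (y m - y n) * norm x" if "n \<le> m" for m n x
    using that
  proof (induction m rule: dec_induct)
    case (step m)
    then show ?case
      using norm_triangle_ineq[of "Y (Suc m) x - Y m x" "Y m x - Y n x"]
        \<open>\<And>n x. y n \<le> y (Suc n) \<and> norm (Y (Suc n) x - Y n x) \<le> (y (Suc n) - y n) * norm x\<close>[of m x]
      by (simp add: algebra_simps)
  qed simp
  have "convergent y"
    unfolding convergent_def using incseq_convergent[OF incy, of 1] y01 by blast
  then have Cy: "Cauchy y" by (simp add: Cauchy_convergent_iff)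
  have "Cauchy (\<lambda>n. Y n x)" for x
  proof (rule metric_CauchyI)
    fix e :: real assume "e > 0"
    \<comment> \<open>The added 1 keeps the quotient positive also for \<open>x = 0\<close>.\<close>
    then have "e / (norm x + 1) > 0" by (simp add: add_nonneg_pos)
    then obtain M where M: "\<And>m n. m \<ge> M \<Longrightarrow> n \<ge> M \<Longrightarrow> dist (y m) (y n) < e / (norm x + 1)"
      using metric_CauchyD[OF Cy] by blast
    have "dist (Y m x) (Y n x) < e" if "m \<ge> M" "n \<ge> M" for m n
    proof -
      have "norm (Y m x - Y n x) \<le> \<bar>y m - y n\<bar> * norm x"
      proof (cases "n \<le> m")
        case True
        then show ?thesis using diff[OF True, of x] incseqD[OF incy True] by simp
      next
        case False
        then have "m \<le> n" by simp
        then show ?thesis using diff[of m n x] incseqD[OF incy, of m n] by (simp add: norm_minus_commute)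
      qed
      also have "\<dots> \<le> \<bar>y m - y n\<bar> * (norm x + 1)" by (intro mult_left_mono) auto
      also have "\<dots> < e"
        using M[OF that] by (simp add: dist_real_def pos_less_divide_eq add_nonneg_pos)
      finally show ?thesis by (simp add: dist_norm)
    qed
    then show "\<exists>M. \<forall>m\<ge>M. \<forall>n\<ge>M. dist (Y m x) (Y n x) < e" by blast
  qed
  then have "\<forall>x. \<exists>l. (\<lambda>n. Y n x) \<longlonglongrightarrow> l"
    by (simp add: Cauchy_convergent_iff convergent_def)
  then obtain t where t: "\<And>x. (\<lambda>n. Y n x) \<longlonglongrightarrow> t x" by metis
  have t1: "norm (t x) \<le> norm x" for x
    using LIMSEQ_le_const2[OF tendsto_norm[OF t[of x]]] Y1 by blast
  have "t (x + z) = t x + t z" for x z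
    using LIMSEQ_unique[OF t[of "x + z"]] tendsto_add[OF t[of x] t[of z]]
    by (simp add: blinfun.add_right)
  moreover have "t (c *\<^sub>R x) = c *\<^sub>R t x" for c x
    using LIMSEQ_unique[OF t[of "c *\<^sub>R x"]] tendsto_scaleR[OF tendsto_const t[of x], of c]
    by (simp add: blinfun.scaleR_right)
  ultimately have "bounded_linear t" by (intro bounded_linear_intro[of _ 1]) (auto simp: t1)
  then obtain T where T: "blinfun_apply T = t" using bounded_linear_Blinfun_apply by blast
  \<comment> \<open>The iterates are uniformly contractive, so the outer \<open>Y n\<close> sends
    the null sequence \<open>Y n x - t x\<close> to a null sequence.\<close>
  have tt: "(\<lambda>n. Y n (Y n x)) \<longlonglongrightarrow> t (t x)" for x
  proof -
    have "(\<lambda>n. norm (Y n x - t x)) \<longlonglongrightarrow> 0"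
      using tendsto_norm_zero[OF LIM_zero[OF t[of x]]] .
    then have "(\<lambda>n. Y n (Y n x - t x)) \<longlonglongrightarrow> 0"
      by (rule Lim_null_comparison[rotated]) (simp add: Y1)
    from tendsto_add[OF this t[of "t x"]] show ?thesis by (simp add: blinfun.diff_right)
  qed
  have fix_t: "2 *\<^sub>R t x = X x + t (t x)" for x
  proof -
    have "(\<lambda>n. 2 *\<^sub>R Y (Suc n) x) \<longlonglongrightarrow> X x + t (t x)"
      unfolding YS using tendsto_add[OF tendsto_const[of "X x"] tt[of x]] by simp
    moreover have "(\<lambda>n. 2 *\<^sub>R Y (Suc n) x) \<longlonglongrightarrow> 2 *\<^sub>R t x"
      by (intro tendsto_intros LIMSEQ_Suc t)
    ultimately show ?thesis by (metis LIMSEQ_unique)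
  qed
  \<comment> \<open>The fixed-point equation \<open>2 T = X + T^2\<close> says
    \<open>(1 - T)^2 = 1 - X = B^2\<close>.\<close>
  define S where "S = id_blinfun - T"
  have S: "S x = x - t x" for x by (simp add: S_def blinfun.diff_left T)
  show thesis
  proof (rule that[of S])
    show "S (S x) = B (B x)" for x
    proof -
      have "t (x - t x) = t x - t (t x)" unfolding T[symmetric] by (rule blinfun.diff_right)
      then have "S (S x) = x - 2 *\<^sub>R t x + t (t x)" by (simp add: S scaleR_2)
      also have "\<dots> = B (B x)" unfolding fix_t by (simp add: X)
      finally show ?thesis .
    qed
    show "inner (S x) x \<ge> 0" for x
      using norm_cauchy_schwarz[of "t x" x] mult_right_mono[OF t1[of x] norm_ge_zero[of x]]
      by (simp add: S inner_simps dot_square_norm power2_eq_square)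
    have "inner (t x) z = inner x (t z)" for x z
    proof (rule LIMSEQ_unique)
      show "(\<lambda>n. inner (Y n x) z) \<longlonglongrightarrow> inner (t x) z" by (intro tendsto_intros t)
      show "(\<lambda>n. inner (Y n x) z) \<longlonglongrightarrow> inner x (t z)" unfolding Ysym by (intro tendsto_intros t)
    qed
    then show "inner (S x) z = inner x (S z)" for x z by (simp add: S inner_simps)
    fix C :: "'a \<Rightarrow>\<^sub>L 'a" and x assume C: "\<And>x. C (B x) = B (C x)"
    have "C (t x) = t (C x)"
    proof (rule LIMSEQ_unique)
      show "(\<lambda>n. C (Y n x)) \<longlonglongrightarrow> C (t x)" by (intro tendsto_intros t)
      show "(\<lambda>n. C (Y n x)) \<longlonglongrightarrow> t (C x)" unfolding comm[OF C] by (rule t)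
    qed
    then show "C (S x) = S (C x)" by (simp add: S blinfun.diff_right)
  qed
qed

text \<open>With \<open>S\<close> the absolute value of \<open>c B\<close>, let \<open>s\<close> be
  1 on the kernel \<open>P\<close> of \<open>S - c B\<close> and -1 on its orthogonal complement;
  then \<open>s\<close> composed with \<open>c B\<close> is \<open>S\<close>. The kernel of
  \<open>B\<close> falls into \<open>P\<close>, so \<open>s\<close> is a full unitary.\<close>

lemma sign_operator_exists:
  fixes J B :: "'a::{real_inner, complete_space} \<Rightarrow>\<^sub>L 'a"
  assumes J: "complex_structure J" and sym: "\<And>x y. inner (B x) y = inner x (B y)"
    and BJ: "\<And>x. B (J x) = J (B x)"
  obtains s where "symmetric_unitary J s" "\<And>x. s (B x) = B (s x)" "\<And>x. inner (s (B x)) x \<ge> 0"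
proof -
  \<comment> \<open>The added 1 keeps \<open>c\<close> positive even for \<open>B = 0\<close>, so
    that it can be divided out at the end.\<close>
  define c where "c = inverse (norm B + 1)"
  have c: "c > 0" by (simp add: c_def add_nonneg_pos)
  have "norm B \<le> norm B + 1" by simp
  then have nc: "norm (c *\<^sub>R B) \<le> 1" by (simp add: c_def divide_simps add_nonneg_pos)
  have symc: "inner ((c *\<^sub>R B) x) z = inner x ((c *\<^sub>R B) z)" for x z
    by (simp add: blinfun.scaleR_left sym)
  show thesis
  proof (rule abs_operator_exists[OF symc nc])
    fix S :: "'a \<Rightarrow>\<^sub>L 'a"
    assume SS: "\<And>x. S (S x) = (c *\<^sub>R B) ((c *\<^sub>R B) x)" and Spos: "\<And>x. inner (S x) x \<ge> 0"
      and Ssym: "\<And>x y. inner (S x) y = inner x (S y)"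
      and Scomm: "\<And>(C :: 'a \<Rightarrow>\<^sub>L 'a) x. (\<And>x. C ((c *\<^sub>R B) x) = (c *\<^sub>R B) (C x)) \<Longrightarrow> C (S x) = S (C x)"
    have SB: "B (S x) = S (B x)" for x
      by (rule Scomm) (simp add: blinfun.scaleR_left blinfun.scaleR_right)
    have SJ: "J (S x) = S (J x)" for x
      by (rule Scomm) (simp add: blinfun.scaleR_left blinfun.scaleR_right BJ)
    define P where "P = {x. S x = c *\<^sub>R B x}"
    have P: "subspace P" "closed P"
      unfolding P_def
      by (auto simp: subspace_def blinfun.add_right blinfun.scaleR_right algebra_simps
          intro!: closed_Collect_eq continuous_intros)
    have PJ: "J x \<in> P" if "x \<in> P" for x
      using that by (simp add: P_def BJ blinfun.scaleR_right flip: SJ)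
    have PB: "B x \<in> P" if "x \<in> P" for x
      using that by (simp add: P_def blinfun.scaleR_right flip: SB)
    \<comment> \<open>The product of \<open>S - c B\<close> and \<open>S + c B\<close> is
      \<open>S^2 - (c B)^2 = 0\<close>. By symmetry, \<open>S + c B\<close> then kills every vector
      orthogonal to \<open>P\<close>.\<close>
    have ran: "S x + c *\<^sub>R B x \<in> P" for x
      by (simp add: P_def blinfun.add_right blinfun.scaleR_right blinfun.scaleR_left SS SB algebra_simps)
    obtain u where u: "symmetric_unitary J u" "\<And>x. x \<in> P \<Longrightarrow> u x = - x"
      "\<And>x. (\<And>z. z \<in> P \<Longrightarrow> inner x z = 0) \<Longrightarrow> u x = x"
      using reflection_exists[OF J P PJ] by metis
    have split: "u (B x) = B (u x) \<and> - (u (c *\<^sub>R B x)) = S x" for x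
    proof -
      obtain p where p: "p \<in> P" "\<And>z. z \<in> P \<Longrightarrow> inner (x - p) z = 0"
        using orthogonal_decomposition[OF P] by metis
      define q where "q = x - p"
      have x: "x = p + q" by (simp add: q_def)
      have q: "inner q z = 0" if "z \<in> P" for z using p(2)[OF that] by (simp add: q_def)
      have Bq: "inner (B q) z = 0" if "z \<in> P" for z using q[OF PB[OF that]] by (simp add: sym)
      have "inner (S q + c *\<^sub>R B q) z = 0" for z
        using q[OF ran, of z] by (simp add: inner_simps sym Ssym)
      then have "S q + c *\<^sub>R B q = 0" by (metis inner_eq_zero_iff)
      then have Sq: "S q = - (c *\<^sub>R B q)" by (simp add: eq_neg_iff_add_eq_0)
      have "u p = - p" "u q = q" "u (B p) = - B p" "u (B q) = B q"
        using u(2)[OF p(1)] u(3)[of q, OF q] u(2)[OF PB[OF p(1)]] u(3)[of "B q", OF Bq] by auto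
      moreover have "S p = c *\<^sub>R B p" using p(1) by (simp add: P_def)
      ultimately show ?thesis using Sq
        by (simp add: x blinfun.add_right blinfun.diff_right blinfun.minus_right blinfun.scaleR_right
            scaleR_add_right)
    qed
    \<comment> \<open>The reflection \<open>u\<close> negates \<open>P\<close>, where
      \<open>B\<close> is nonnegative, so the sign is \<open>- u\<close>.\<close>
    show thesis
    proof (rule that[of "- u"])
      show "symmetric_unitary J (- u)"
        using u(1) by (simp add: symmetric_unitary_def uminus_blinfun.rep_eq blinfun.minus_right)
      show "(- u) (B x) = B ((- u) x)" for x
        using split[of x] by (simp add: uminus_blinfun.rep_eq blinfun.minus_right)
      have "inner (S x) x = c * inner ((- u) (B x)) x" for x
        using conjunct2[OF split[of x], symmetric]
        by (simp add: uminus_blinfun.rep_eq blinfun.scaleR_right)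
      then show "inner ((- u) (B x)) x \<ge> 0" for x
        using Spos[of x] c by (simp add: zero_le_mult_iff)
    qed
  qed
qed

section \<open>Comparison of complementary subspaces\<close>

text \<open>The \<open>\<plusminus>1\<close> eigenspaces of \<open>s\<close> are compared by the reflection in a maximal complex subspace that is
  neutral for the form \<open>inner (s x) y\<close>: such a subspace is the graph of a partial isometry
  between the two eigenspaces, and maximality makes the form definite on what is left over.\<close>

lemma comparison_reflection_exists:
  fixes J s :: "'a::{real_inner, complete_space} \<Rightarrow>\<^sub>L 'a"
  assumes J: "complex_structure J" and s: "symmetric_unitary J s"
  obtains u where "symmetric_unitary J u"
    "(\<forall>x. inner (s x) x + inner (s (u x)) (u x) \<le> 0) \<or>
     (\<forall>x. inner (s x) x + inner (s (u x)) (u x) \<ge> 0)"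
proof -
  note s = symmetric_unitaryD[OF s] and J' = complex_structureD[OF J]
  \<comment> \<open>The two equations are the real and imaginary parts of orthogonality for the
    hermitian form given by \<open>s\<close>.\<close>
  define R where "R x y \<longleftrightarrow> inner (s x) y = 0 \<and> inner (s x) (J y) = 0" for x y
  have Rsym: "R x y \<longleftrightarrow> R y x" for x y
  proof -
    have "inner (s x) y = inner (s y) x" by (metis s(3) inner_commute)
    moreover have "inner (s x) (J y) = - inner (s y) (J x)"
      by (metis J'(3) s(2,3) inner_commute)
    ultimately show ?thesis by (simp add: R_def)
  qed
  \<comment> \<open>The imaginary part vanishes on the diagonal because \<open>s\<close> composed
    with \<open>J\<close> is skew.\<close>
  have Rself: "R x x \<longleftrightarrow> inner (s x) x = 0" for x
  proof -
    have "inner (s x) (J x) = - inner (s x) (J x)"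
      by (metis J'(3) s(2,3) inner_commute)
    then show ?thesis by (simp add: R_def)
  qed
  have RJ: "R (J x) y" if "R x y" for x y
    using that by (simp add: R_def s(2) J'(1,3))
  \<comment> \<open>Zorn's lemma is applied to arbitrary mutually neutral sets, whose chains have
    evident upper bounds. Linearity, closedness and invariance under \<open>J\<close> are recovered
    from maximality through \<open>N_iff\<close>.\<close>
  define \<A> where "\<A> = {N. \<forall>x\<in>N. \<forall>y\<in>N. R x y}"
  have "\<exists>N\<in>\<A>. \<forall>N'\<in>\<A>. N \<subseteq> N' \<longrightarrow> N' = N"
  proof (rule subset_Zorn_nonempty)
    show "\<A> \<noteq> {}" by (auto simp: \<A>_def)
    show "\<Union> \<C> \<in> \<A>" if "\<C> \<noteq> {}" "subset.chain \<A> \<C>" for \<C>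
    proof -
      have "R x y" if "x \<in> N" "y \<in> N'" "N \<in> \<C>" "N' \<in> \<C>" for x y N N'
        using \<open>subset.chain \<A> \<C>\<close> that unfolding subset_chain_def \<A>_def by blast
      then show ?thesis by (auto simp: \<A>_def)
    qed
  qed
  then obtain N where "N \<in> \<A>" and max: "\<And>N'. N' \<in> \<A> \<Longrightarrow> N \<subseteq> N' \<Longrightarrow> N' = N" by blast
  then have N: "R x y" if "x \<in> N" "y \<in> N" for x y using that by (simp add: \<A>_def)
  have N_iff: "z \<in> N \<longleftrightarrow> (\<forall>y\<in>N. R z y) \<and> inner (s z) z = 0" for z
  proof
    assume z: "(\<forall>y\<in>N. R z y) \<and> inner (s z) z = 0"
    then have "R z z" using Rself by blast
    then have "insert z N \<in> \<A>" using z N Rsym unfolding \<A>_def by blast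
    from max[OF this] show "z \<in> N" by blast
  qed (use N Rself in blast)
  have sub: "subspace N"
  proof (unfold subspace_def, intro conjI ballI allI)
    show "0 \<in> N" by (subst N_iff) (simp add: R_def)
    show "x + y \<in> N" if "x \<in> N" "y \<in> N" for x y
      using N that N[OF that] N[OF that(2,1)] by (subst N_iff) (simp add: R_def blinfun.add_right inner_simps)
    show "c *\<^sub>R x \<in> N" if "x \<in> N" for c x
      using N that N[OF that that] by (subst N_iff) (simp add: R_def blinfun.scaleR_right inner_simps)
  qed
  have "N = (\<Inter>y\<in>N. {z. inner (s z) y = 0} \<inter> {z. inner (s z) (J y) = 0}) \<inter> {z. inner (s z) z = 0}"
    using N_iff unfolding R_def by blast
  also have "closed \<dots>"
    by (intro closed_Int closed_INT ballI closed_Collect_eq continuous_intros)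
  finally have cl: "closed N" .
  have NJ: "J x \<in> N" if "x \<in> N" for x
    using N[OF that] N[OF that that] RJ[OF N[OF that]] by (subst N_iff) (auto simp: R_def s(2) J'(2))
  obtain u where u: "symmetric_unitary J u" "\<And>x. x \<in> N \<Longrightarrow> u x = - x"
    "\<And>x. (\<And>z. z \<in> N \<Longrightarrow> inner x z = 0) \<Longrightarrow> u x = x"
    using reflection_exists[OF J sub cl NJ] by metis
  \<comment> \<open>Since \<open>s\<close> is symmetric, \<open>M\<close> is the orthogonal
    complement of \<open>N + s N\<close>; it is invariant under \<open>s\<close>.\<close>
  define M where "M = {m. \<forall>n\<in>N. inner m n = 0 \<and> inner (s m) n = 0}"
  \<comment> \<open>A neutral vector of \<open>M\<close> could be adjoined to \<open>N\<close>, so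
    it lies in \<open>N\<close> and is orthogonal to itself.\<close>
  have M_aniso: "m = 0" if m: "m \<in> M" "inner (s m) m = 0" for m
  proof -
    have "m \<in> N" using m NJ by (subst N_iff) (auto simp: M_def R_def)
    then have "inner m m = 0" using m(1) by (auto simp: M_def)
    then show ?thesis by simp
  qed
  have M_def_sign: "(\<forall>m\<in>M. inner (s m) m \<le> 0) \<or> (\<forall>m\<in>M. inner (s m) m \<ge> 0)"
  proof (rule ccontr)
    assume "\<not> ?thesis"
    then obtain a b where ab: "a \<in> M" "b \<in> M" "inner (s a) a > 0" "inner (s b) b < 0"
      by (meson not_le)
    \<comment> \<open>Up to a factor 2 these are the components of \<open>a\<close> and
      \<open>b\<close> in the +1 and -1 eigenspaces of \<open>s\<close>; the signs of the form keep
      them from vanishing.\<close>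
    define a' b' where "a' = a + s a" and "b' = b - s b"
    have sa: "s a' = a'" and sb: "s b' = - b'"
      by (simp_all add: a'_def b'_def blinfun.add_right blinfun.diff_right s(1))
    have a0: "a' \<noteq> 0"
    proof
      assume "a' = 0"
      then have "s a = - a" by (simp add: a'_def eq_neg_iff_add_eq_0 add.commute)
      with ab(3) show False using inner_ge_zero[of a] by simp
    qed
    have b0: "b' \<noteq> 0"
    proof
      assume "b' = 0"
      then have "s b = b" by (simp add: b'_def)
      with ab(4) show False using inner_ge_zero[of b] by simp
    qed
    \<comment> \<open>The coefficients give both summands equal norm, so their contributions to the
      form cancel: \<open>w\<close> is a neutral vector of \<open>M\<close>.\<close>
    define w where "w = norm b' *\<^sub>R a' + norm a' *\<^sub>R b'"
    have sw: "s w = norm b' *\<^sub>R a' - norm a' *\<^sub>R b'"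
      by (simp add: w_def blinfun.add_right blinfun.scaleR_right sa sb)
    have "w \<in> M" using ab(1,2)
      by (simp add: M_def w_def a'_def b'_def blinfun.add_right blinfun.diff_right
          blinfun.scaleR_right s(1) inner_simps)
    moreover have "inner (s w) w = 0"
      unfolding sw unfolding w_def
      by (simp add: inner_simps inner_commute dot_square_norm power2_eq_square algebra_simps)
    ultimately have "w = 0" by (rule M_aniso)
    then have "w + s w = 0" by simp
    then have "(2 * norm b') *\<^sub>R a' = 0" unfolding sw unfolding w_def by (simp add: scaleR_2 flip: scaleR_scaleR)
    with a0 b0 show False by simp
  qed
  \<comment> \<open>Write \<open>x = n + s k + m\<close> with \<open>n\<close>, \<open>k\<close> in
    \<open>N\<close> and \<open>m\<close> in \<open>M\<close>. The form has value 0 on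
    \<open>n\<close> and on \<open>s k\<close>, and \<open>u\<close> changes only the sign of
    \<open>n\<close>, so the cross terms of \<open>n\<close> and \<open>s k\<close> cancel in the
    sum.\<close>
  have key: "\<exists>m\<in>M. inner (s x) x + inner (s (u x)) (u x) = 2 * inner (s m) m" for x
  proof -
    obtain n where n: "n \<in> N" "\<And>z. z \<in> N \<Longrightarrow> inner (x - n) z = 0"
      using orthogonal_decomposition[OF sub cl] by metis
    obtain k where k: "k \<in> N" "\<And>z. z \<in> N \<Longrightarrow> inner (s x - k) z = 0"
      using orthogonal_decomposition[OF sub cl] by metis
    \<comment> \<open>Neutrality makes \<open>N\<close> and \<open>s N\<close> orthogonal, and
      \<open>s k\<close> is the projection of \<open>x\<close> onto \<open>s N\<close>.\<close>
    define m where "m = x - n - s k"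
    have ortho: "inner (s z) z' = 0" "inner z (s z') = 0" if "z \<in> N" "z' \<in> N" for z z'
      using N[OF that] by (simp_all add: R_def s(3))
    have m1: "inner m z = 0" if "z \<in> N" for z
      using n(2)[OF that] ortho(1)[OF k(1) that] by (simp add: m_def inner_simps)
    have m2: "inner (s m) z = 0" if "z \<in> N" for z
      using k(2)[OF that] ortho(1)[OF n(1) that]
      by (simp add: m_def inner_simps blinfun.diff_right s(1))
    have zero: "inner m z = 0" "inner z m = 0" "inner (s m) z = 0" "inner z (s m) = 0"
      "inner m (s z) = 0" "inner (s z) m = 0" if "z \<in> N" for z
      using m1[OF that] m2[OF that] s(3) by (simp_all add: inner_commute)
    have x: "x = n + s k + m" by (simp add: m_def)
    have "u (s k + m) = s k + m"
      by (rule u(3)) (simp add: inner_simps m1 ortho k(1))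
    then have ux: "u x = - n + s k + m"
      using u(2)[OF n(1)] by (simp add: x blinfun.add_right)
    have "inner (s x) x + inner (s (u x)) (u x) = 2 * inner (s m) m"
      unfolding ux unfolding x
      by (simp add: blinfun.add_right blinfun.diff_right blinfun.minus_right inner_simps s(1,4)
          zero ortho n(1) k(1) inner_commute[of k n])
    moreover have "m \<in> M" using m1 m2 by (simp add: M_def)
    ultimately show ?thesis by blast
  qed
  have "(\<forall>x. inner (s x) x + inner (s (u x)) (u x) \<le> 0) \<or>
     (\<forall>x. inner (s x) x + inner (s (u x)) (u x) \<ge> 0)"
    using M_def_sign
  proof (elim disjE)
    assume "\<forall>m\<in>M. inner (s m) m \<le> 0"
    then have "inner (s x) x + inner (s (u x)) (u x) \<le> 0" for x using key[of x] by auto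
    then show ?thesis by blast
  next
    assume "\<forall>m\<in>M. inner (s m) m \<ge> 0"
    then have "inner (s x) x + inner (s (u x)) (u x) \<ge> 0" for x using key[of x] by auto
    then show ?thesis by blast
  qed
  with u(1) show ?thesis using that by blast
qed


section \<open>Averaging\<close>

text \<open>Polarise the form at \<open>x\<close> and a multiple \<open>y\<close> of
  \<open>B x\<close> rescaled to the norm of \<open>x\<close>, then apply the parallelogram
  law.\<close>

lemma symmetric_norm_le:
  fixes B :: "'a::real_inner \<Rightarrow>\<^sub>L 'a"
  assumes sym: "\<And>x y. inner (B x) y = inner x (B y)"
    and w: "\<And>x. \<bar>inner (B x) x\<bar> \<le> w * inner x x" "w \<ge> 0"
  shows "norm B \<le> w"
proof (rule norm_blinfun_bound)
  show "norm (B x) \<le> w * norm x" for x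
  proof (cases "B x = 0 \<or> x = 0")
    case False
    define t where "t = norm x / norm (B x)"
    have t: "t > 0" using False by (simp add: t_def)
    define y where "y = t *\<^sub>R B x"
    have "4 * inner (B x) y = inner (B (x + y)) (x + y) - inner (B (x - y)) (x - y)"
      using sym[of y x]
      by (simp add: blinfun.add_right blinfun.diff_right inner_simps inner_commute[of "B y" x] inner_commute[of y "B x"] inner_commute[of y "B y"])
    also have "\<dots> \<le> w * inner (x + y) (x + y) + w * inner (x - y) (x - y)"
      using w(1)[of "x + y"] w(1)[of "x - y"] by linarith
    also have "\<dots> = 2 * w * (inner x x + inner y y)"
      by (simp add: inner_simps inner_commute algebra_simps)
    also have "inner y y = inner x x"
      using False by (simp add: y_def t_def dot_square_norm power2_eq_square)
    also have "inner (B x) y = norm x * norm (B x)"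
      using False by (simp add: y_def t_def dot_square_norm power2_eq_square)
    finally have "norm x * norm (B x) \<le> norm x * (w * norm x)"
      by (simp add: dot_square_norm power2_eq_square mult_ac)
    then show ?thesis using False by simp
  qed (use w(2) in auto)
qed (rule w(2))

text \<open>Since \<open>B\<close> is at most \<open>w\<close> on the +1 eigenspace of
  \<open>s\<close> and at most 0 on the other, \<open>B\<close> is bounded by
  \<open>w (1 + s)/2\<close>. Adding the conjugate by \<open>u\<close> makes the contribution of
  \<open>s\<close> nonpositive. The lower bound only uses the norm of \<open>B\<close>.\<close>

lemma average_form_bounds:
  fixes B s u :: "'a::real_inner \<Rightarrow>\<^sub>L 'a"
  assumes sym: "\<And>x y. inner (B x) y = inner x (B y)" and nB: "norm B \<le> w"
    and s: "symmetric_unitary J s" "\<And>x. s (B x) = B (s x)" "\<And>x. inner (s (B x)) x \<ge> 0"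
    and u: "symmetric_unitary J u"
    and le: "\<And>x. inner (s x) x + inner (s (u x)) (u x) \<le> 0"
  shows "inner (B x) x + inner (B (u x)) (u x) \<le> w * inner x x"
    and "inner (B x) x + inner (B (u x)) (u x) \<ge> - 2 * w * inner x x"
proof -
  note s' = symmetric_unitaryD[OF s(1)]
  have w0: "w \<ge> 0" using nB norm_ge_zero[of B] by linarith
  have abs: "\<bar>inner (B x) x\<bar> \<le> w * inner x x" for x
  proof -
    have "\<bar>inner (B x) x\<bar> \<le> norm (B x) * norm x" by (rule Cauchy_Schwarz_ineq2)
    also have "\<dots> \<le> (w * norm x) * norm x"
      by (intro mult_right_mono order_trans[OF norm_blinfun] nB) auto
    finally show ?thesis by (simp add: dot_square_norm power2_eq_square)
  qed
  have upper: "2 * inner (B x) x \<le> w * (inner x x + inner (s x) x)" for x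
  proof -
    \<comment> \<open>Splitting along the eigenspaces of \<open>s\<close> leaves no cross term,
      because \<open>B\<close> commutes with \<open>s\<close>.\<close>
    define p q where "p = x + s x" and "q = x - s x"
    have sp: "s p = p" and sq: "s q = - q"
      by (simp_all add: p_def q_def blinfun.add_right blinfun.diff_right s'(1))
    have "inner (B p) q = inner (s (B p)) q" by (simp add: s(2) sp)
    also have "\<dots> = - inner (B p) q" by (simp add: s'(3) sq)
    finally have pq: "inner (B p) q = 0" by simp
    have "inner (s (B q)) q = - inner (B q) q" by (simp add: s'(3) sq)
    with s(3)[of q] have qq: "inner (B q) q \<le> 0" by simp
    have "2 *\<^sub>R x = p + q" by (simp add: p_def q_def scaleR_2)
    then have "inner (B (2 *\<^sub>R x)) (2 *\<^sub>R x) = inner (B (p + q)) (p + q)" by simp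
    then have "4 * inner (B x) x = inner (B p) p + inner (B q) q + 2 * inner (B p) q"
      using sym[of q p]
      by (simp add: blinfun.add_right blinfun.scaleR_right inner_simps inner_commute)
    also have "\<dots> \<le> w * inner p p" using pq qq abs[of p] by linarith
    also have "inner p p = 2 * (inner x x + inner (s x) x)"
      by (simp add: p_def inner_simps s'(4) inner_commute)
    finally show ?thesis by (simp add: algebra_simps)
  qed
  have uu: "inner (u x) (u x) = inner x x" using symmetric_unitaryD(4)[OF u] .
  have "2 * (inner (B x) x + inner (B (u x)) (u x)) \<le>
      w * (inner x x + inner (s x) x) + w * (inner x x + inner (s (u x)) (u x))"
    using upper[of x] upper[of "u x"] by (simp add: uu)
  also have "\<dots> = 2 * (w * inner x x) + w * (inner (s x) x + inner (s (u x)) (u x))"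
    by (simp add: algebra_simps)
  also have "\<dots> \<le> 2 * (w * inner x x)"
    using mult_nonneg_nonpos[OF w0 le[of x]] by simp
  finally show "inner (B x) x + inner (B (u x)) (u x) \<le> w * inner x x" by simp
  show "inner (B x) x + inner (B (u x)) (u x) \<ge> - 2 * w * inner x x"
    using abs[of x] abs[of "u x"] by (simp add: uu)
qed

section \<open>Midpoints of an operator and its conjugate\<close>

definition average :: "('a::real_normed_vector \<Rightarrow>\<^sub>L 'a) \<Rightarrow> ('a \<Rightarrow>\<^sub>L 'a) \<Rightarrow> ('a \<Rightarrow>\<^sub>L 'a)" where
  "average u B = (1/2) *\<^sub>R (B + (u o\<^sub>L B o\<^sub>L u))"

lemma average_apply: "average u B x = (1/2) *\<^sub>R (B x + u (B (u x)))"
  by (simp add: average_def blinfun.add_left blinfun.scaleR_left)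

lemma average_near_scalar:
  fixes J B :: "'a::{real_inner, complete_space} \<Rightarrow>\<^sub>L 'a"
  assumes J: "complex_structure J" and sym: "\<And>x y. inner (B x) y = inner x (B y)"
    and BJ: "\<And>x. B (J x) = J (B x)" and nB: "norm B \<le> w"
  obtains u c where "symmetric_unitary J u" "norm (average u B - c *\<^sub>R id_blinfun) \<le> 3/4 * w"
proof -
  have w0: "w \<ge> 0" using nB norm_ge_zero[of B] by linarith
  obtain s where s: "symmetric_unitary J s" "\<And>x. s (B x) = B (s x)" "\<And>x. inner (s (B x)) x \<ge> 0"
    using sign_operator_exists[OF J sym BJ] by metis
  obtain u where u: "symmetric_unitary J u"
    and cmp: "(\<forall>x. inner (s x) x + inner (s (u x)) (u x) \<le> 0) \<or>
     (\<forall>x. inner (s x) x + inner (s (u x)) (u x) \<ge> 0)"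
    using comparison_reflection_exists[OF J s(1)] by metis
  note u' = symmetric_unitaryD[OF u]
  have form: "inner ((average u B - c *\<^sub>R id_blinfun) x) x =
      (inner (B x) x + inner (B (u x)) (u x)) / 2 - c * inner x x" for c x
    by (simp add: blinfun.diff_left blinfun.scaleR_left average_apply inner_simps u'(3))
  have avsym: "inner ((average u B - c *\<^sub>R id_blinfun) x) y
      = inner x ((average u B - c *\<^sub>R id_blinfun) y)" for c x y
    by (simp add: blinfun.diff_left blinfun.scaleR_left average_apply inner_simps u'(3) sym)
  from cmp show thesis
  proof
    assume le: "\<forall>x. inner (s x) x + inner (s (u x)) (u x) \<le> 0"
    note b = average_form_bounds[OF sym nB s u le[rule_format]]
    \<comment> \<open>The form of the average lies between \<open>- w\<close> and
      \<open>w/2\<close>; \<open>- w/4\<close> is the midpoint and \<open>3/4 * w\<close> the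
      half-length.\<close>
    have "\<bar>inner ((average u B - (- w/4) *\<^sub>R id_blinfun) x) x\<bar> \<le> 3/4 * w * inner x x" for x
      unfolding form using b[of x] by (intro abs_leI) (simp_all add: uminus_blinfun.rep_eq field_simps)
    then show thesis using that[OF u] symmetric_norm_le[OF avsym] w0 by fastforce
  next
    assume ge: "\<forall>x. inner (s x) x + inner (s (u x)) (u x) \<ge> 0"
    \<comment> \<open>Replacing \<open>B\<close> and \<open>s\<close> by their negatives reverses
      the comparison and leaves the product of \<open>s\<close> and \<open>B\<close>
      unchanged.\<close>
    have "norm (- B) \<le> w" using nB by simp
    moreover have "inner ((- B) x) y = inner x ((- B) y)" for x y
      by (simp add: uminus_blinfun.rep_eq sym)
    moreover have "symmetric_unitary J (- s)"
      using s(1) by (simp add: symmetric_unitary_def uminus_blinfun.rep_eq blinfun.minus_right)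
    moreover have "(- s) ((- B) x) = (- B) ((- s) x)" "inner ((- s) ((- B) x)) x \<ge> 0" for x
      using s(2,3)[of x] by (simp_all add: uminus_blinfun.rep_eq blinfun.minus_right)
    moreover have "inner ((- s) x) x + inner ((- s) (u x)) (u x) \<le> 0" for x
      using ge[rule_format, of x] by (simp add: uminus_blinfun.rep_eq)
    ultimately have b: "inner ((- B) x) x + inner ((- B) (u x)) (u x) \<le> w * inner x x"
      "inner ((- B) x) x + inner ((- B) (u x)) (u x) \<ge> - 2 * w * inner x x" for x
      using average_form_bounds[of "- B" w J "- s" u, OF _ _ _ _ _ u] by blast+
    have "\<bar>inner ((average u B - (w/4) *\<^sub>R id_blinfun) x) x\<bar> \<le> 3/4 * w * inner x x" for x
      unfolding form using b[of x] by (intro abs_leI) (simp_all add: uminus_blinfun.rep_eq field_simps)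
    then show thesis using that[OF u] symmetric_norm_le[OF avsym] w0 by fastforce
  qed
qed

section \<open>Open invariant cones\<close>

lemma u_algD:
  assumes "T \<in> u_alg J"
  shows "T (J x) = J (T x)" "inner (T x) y = - inner x (T y)"
proof -
  show "T (J x) = J (T x)"
    using assms blinfun_apply_blinfun_compose[of T J x] blinfun_apply_blinfun_compose[of J T x]
    by (simp add: u_alg_def)
  show "inner (T x) y = - inner x (T y)" using assms by (simp add: u_alg_def)
qed

lemma u_algI:
  fixes J T :: "'a::real_inner \<Rightarrow>\<^sub>L 'a"
  assumes "\<And>x. T (J x) = J (T x)" "\<And>x y. inner (T x) y = - inner x (T y)"
  shows "T \<in> u_alg J"
  using assms by (auto simp: u_alg_def intro: blinfun_eqI)

lemma u_alg_linear:
  assumes "S \<in> u_alg J" "T \<in> u_alg J"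
  shows "S + T \<in> u_alg J" "S - T \<in> u_alg J"
  by (auto intro!: u_algI simp: blinfun.add_left blinfun.diff_left
      blinfun.add_right blinfun.diff_right inner_simps
      u_algD[OF assms(1)] u_algD[OF assms(2)])

lemma u_alg_scale: "T \<in> u_alg J \<Longrightarrow> c *\<^sub>R T \<in> u_alg J"
  by (auto intro!: u_algI simp: blinfun.scaleR_left blinfun.scaleR_right u_algD)

lemma u_alg_conj:
  assumes "symmetric_unitary J u" "T \<in> u_alg J"
  shows "u o\<^sub>L T o\<^sub>L u \<in> u_alg J"
  by (rule u_algI) (simp_all add: symmetric_unitaryD[OF assms(1)] u_algD[OF assms(2)])

lemma symmetric_unitary_pair: "symmetric_unitary J u \<Longrightarrow> unitary_pair J u u"
  by (auto simp: unitary_pair_def symmetric_unitaryD intro: blinfun_eqI)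

lemma norm_conj_le:
  assumes "symmetric_unitary J u"
  shows "norm (u o\<^sub>L T o\<^sub>L u) \<le> norm T"
proof -
  have u: "norm u \<le> 1" by (rule norm_blinfun_le_1) (rule symmetric_unitaryD(5)[OF assms])
  have "norm (u o\<^sub>L T o\<^sub>L u) \<le> norm (u o\<^sub>L T) * norm u" by (rule norm_blinfun_compose)
  also have "\<dots> \<le> norm (u o\<^sub>L T) * 1" by (intro mult_left_mono u) simp
  also have "\<dots> \<le> norm u * norm T" using norm_blinfun_compose[of u T] by simp
  also have "\<dots> \<le> 1 * norm T" by (intro mult_right_mono u) simp
  finally show ?thesis by simp
qed

text \<open>A point at displacement \<open>D\<close> from the average is the midpoint of
  \<open>X + D\<close> and the conjugate of \<open>X + E\<close>, where \<open>E\<close> is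
  \<open>D\<close> conjugated by \<open>u\<close>. Both perturbations are shorter than
  \<open>e\<close>, so no radius is lost.\<close>

lemma average_ball_subset:
  fixes J :: "'a::{real_inner, complete_space} \<Rightarrow>\<^sub>L 'a"
  assumes cone: "convex_cone_set W"
    and inv: "\<And>g h. unitary_pair J g h \<Longrightarrow> (\<lambda>x. g o\<^sub>L x o\<^sub>L h) ` W \<subseteq> W"
    and X: "X \<in> u_alg J" "ball X e \<inter> u_alg J \<subseteq> W" and u: "symmetric_unitary J u"
  shows "average u X \<in> u_alg J" "ball (average u X) e \<inter> u_alg J \<subseteq> W"
proof -
  show av: "average u X \<in> u_alg J"
    unfolding average_def by (intro u_alg_scale u_alg_linear(1) X u_alg_conj u)
  show "ball (average u X) e \<inter> u_alg J \<subseteq> W"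
  proof
    fix Z assume Z: "Z \<in> ball (average u X) e \<inter> u_alg J"
    define D where "D = Z - average u X"
    have D: "D \<in> u_alg J" using Z av by (simp add: D_def u_alg_linear)
    have nD: "norm D < e" using Z by (simp add: D_def dist_norm norm_minus_commute)
    define E where "E = u o\<^sub>L D o\<^sub>L u"
    have "E \<in> u_alg J" "norm E < e"
      using u_alg_conj[OF u D] norm_conj_le[OF u, of D] nD by (auto simp: E_def)
    then have "X + D \<in> W" and XE: "X + E \<in> W"
      using X D nD by (auto simp: u_alg_linear dist_norm intro!: subsetD[OF X(2)])
    moreover have "u o\<^sub>L (X + E) o\<^sub>L u \<in> W"
      using inv[OF symmetric_unitary_pair[OF u]] XE by blast
    ultimately have "(1/2) *\<^sub>R ((X + D) + (u o\<^sub>L (X + E) o\<^sub>L u)) \<in> W"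
      using cone by (simp add: convex_cone_set_def)
    moreover have "(1/2) *\<^sub>R ((X + D) + (u o\<^sub>L (X + E) o\<^sub>L u)) = Z"
    proof (rule blinfun_eqI)
      fix x
      have "((1/2) *\<^sub>R ((X + D) + (u o\<^sub>L (X + E) o\<^sub>L u))) x = average u X x + (1/2) *\<^sub>R (D x + D x)"
        by (simp add: average_apply E_def blinfun.add_left blinfun.scaleR_left blinfun.add_right
            symmetric_unitaryD(1)[OF u] algebra_simps)
      also have "\<dots> = Z x" by (simp add: D_def blinfun.diff_left flip: scaleR_2)
      finally show "((1/2) *\<^sub>R ((X + D) + (u o\<^sub>L (X + E) o\<^sub>L u))) x = Z x" .
    qed
    ultimately show "Z \<in> W" by simp
  qed
qed

section \<open>Approaching the imaginary scalars inside the cone\<close>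

theorem theorem4p6:
  fixes J :: "'a::{real_inner, complete_space} \<Rightarrow>\<^sub>L 'a"
    and W :: "('a \<Rightarrow>\<^sub>L 'a) set"
  assumes "complex_structure J"
    and "W \<subseteq> u_alg J"
    and "W \<noteq> {}"
    and "openin (top_of_set (u_alg J)) W"
    and "convex_cone_set W"
    and "\<And>g h. unitary_pair J g h \<Longrightarrow> (\<lambda>x. g o\<^sub>L x o\<^sub>L h) ` W \<subseteq> W"
  shows "\<exists>r::real. r *\<^sub>R J \<in> W"
proof -
  note J = complex_structureD[OF assms(1)]
  obtain X0 where X0: "X0 \<in> W" using assms(3) by blast
  obtain e where e: "e > 0" "ball X0 e \<inter> u_alg J \<subseteq> W"
    using assms(4) X0 unfolding openin_contains_ball by blast
  have step: "\<exists>X' c'. X' \<in> u_alg J \<and> ball X' e \<inter> u_alg J \<subseteq> W \<and> norm (X' - c' *\<^sub>R J) \<le> 3/4 * w"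
    if X: "X \<in> u_alg J" "ball X e \<inter> u_alg J \<subseteq> W" "norm (X - c *\<^sub>R J) \<le> w" for X c w
  proof -
    have JX: "X (J x) = J (X x)" "inner (X x) y = - inner x (X y)" for x y
      using u_algD[OF X(1)] by auto
    \<comment> \<open>Multiplication by \<open>- J\<close> turns the skew operator
      \<open>X - c J\<close> into a symmetric one that commutes with \<open>J\<close>.\<close>
    define B where "B = - (J o\<^sub>L (X - c *\<^sub>R J))"
    have B: "B x = - J (X x) - c *\<^sub>R x" for x
      by (simp add: B_def uminus_blinfun.rep_eq blinfun.diff_left blinfun.diff_right
          blinfun.scaleR_left blinfun.scaleR_right J(1))
    have "norm J \<le> 1" by (rule norm_blinfun_le_1) (rule J(4))
    then have "norm B \<le> 1 * w"
      unfolding B_def norm_minus_cancel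
      by (intro order_trans[OF norm_blinfun_compose] mult_mono X) auto
    then have nB: "norm B \<le> w" by simp
    have symB: "inner (B x) y = inner x (B y)" for x y
      by (simp add: B inner_simps J(3) JX)
    have BJ: "B (J x) = J (B x)" for x
      by (simp add: B JX(1) J(1) blinfun.diff_right blinfun.minus_right blinfun.scaleR_right)
    obtain u d where u: "symmetric_unitary J u" "norm (average u B - d *\<^sub>R id_blinfun) \<le> 3/4 * w"
      using average_near_scalar[OF assms(1) symB BJ nB] by metis
    \<comment> \<open>Multiplying back by \<open>J\<close> turns the scalar shift \<open>d\<close>
      into a shift along \<open>J\<close>; averaging fixes \<open>J\<close>, because
      \<open>u\<close> commutes with it.\<close>
    have "average u X - (c + d) *\<^sub>R J = J o\<^sub>L (average u B - d *\<^sub>R id_blinfun)"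
      by (rule blinfun_eqI)
        (simp add: average_apply B blinfun.diff_left blinfun.diff_right blinfun.add_left
          blinfun.add_right blinfun.minus_right blinfun.scaleR_left blinfun.scaleR_right
          J(1) symmetric_unitaryD(1,2)[OF u(1)] algebra_simps flip: scaleR_add_left)
    also have "norm \<dots> \<le> 1 * (3/4 * w)"
      using \<open>norm J \<le> 1\<close> by (intro order_trans[OF norm_blinfun_compose] mult_mono u(2)) auto
    finally have "norm (average u X - (c + d) *\<^sub>R J) \<le> 3/4 * w" by simp
    then show ?thesis
      using average_ball_subset[OF assms(5,6) X(1,2) u(1)] by blast
  qed
  have iter: "\<exists>X c. X \<in> u_alg J \<and> ball X e \<inter> u_alg J \<subseteq> W \<and> norm (X - c *\<^sub>R J) \<le> (3/4) ^ n * norm X0" for n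
  proof (induction n)
    case 0
    have "norm (X0 - 0 *\<^sub>R J) \<le> (3/4) ^ 0 * norm X0" by simp
    then show ?case using e(2) X0 assms(2) by blast
  next
    case (Suc n)
    then obtain X c where "X \<in> u_alg J" "ball X e \<inter> u_alg J \<subseteq> W"
      "norm (X - c *\<^sub>R J) \<le> (3/4) ^ n * norm X0" by blast
    from step[OF this] show ?case by (simp add: mult.assoc)
  qed
  have "(\<lambda>n. (3/4) ^ n * norm X0) \<longlonglongrightarrow> 0 * norm X0"
    by (intro tendsto_intros LIMSEQ_power_zero) simp
  then have "\<forall>\<^sub>F n in sequentially. (3/4) ^ n * norm X0 < e"
    using e(1) by (intro order_tendstoD(2)) auto
  then obtain n where "(3/4) ^ n * norm X0 < e"
    by (meson eventually_happens' sequentially_bot)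
  \<comment> \<open>The radius \<open>e\<close> does not depend on \<open>n\<close>, so once the
    centre is closer than \<open>e\<close> to \<open>c J\<close>, that multiple lies in the
    ball.\<close>
  with iter[of n] obtain X c where X: "ball X e \<inter> u_alg J \<subseteq> W" "norm (X - c *\<^sub>R J) < e"
    using le_less_trans by blast
  have "c *\<^sub>R J \<in> u_alg J"
    by (rule u_algI) (simp_all add: blinfun.scaleR_left blinfun.scaleR_right J(3))
  then have "c *\<^sub>R J \<in> W" using X by (intro subsetD[OF X(1)]) (simp add: dist_norm)
  then show ?thesis by blast
qed

end
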